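(* Let $\Pi$ be a valid collocation projection (relative to the polynomial degree $p$), and let $\alpha,\beta$ be real splitting coefficients with $\alpha+\beta=1$. Write $\Delta_{ijk}=\Delta_{ijk}(\alpha,\beta)$ for the aliasing error tensor. (a) If $u(x,t)=\sum_{k=0}^p u_k(t)L_k(x)$ satisfies the split form DG semi-discretization of the Burgers equation with coefficients $\alpha,\beta$ and numerical flux $f^*$ for every $\phi\in\mathcal{P}^p$, then its discrete entropy equation is $$\frac{d}{dt}\,\frac12\sum_{k=0}^p u_k^2\int_\Omega\Pi(L_k^2)\,d\Omega-\int_\Gamma\Bigl(\frac16u^3-u f^*\Bigr)\hat n\,d\Gamma=-\frac12\sum_{i,j,k=0}^p u_iu_ju_k\,\Delta_{ijk}=-\frac16\sum_{i,j,k=0}^p u_iu_ju_k\,\bigl(\Delta_{ijk}+\Delta_{kij}+\Delta_{kji}\bigr).$$ (b) For all $0\le i,j,k\le p$, $$\Delta_{ijk}+\Delta_{kij}+\Delta_{kji}=(1-3\beta)\int_\Gamma L_iL_jL_k\,\hat n\,d\Gamma+(2\beta-\alpha)\int_\Omega\Bigl(\frac{dL_i}{dx}\Pi(L_jL_k)+\frac{dL_j}{dx}\Pi(L_iL_k)+\frac{dL_k}{dx}\Pi(L_iL_j)\Bigr)d\Omega .$$ (c) The tensor satisfies the skew-symmetry relation $$\Delta_{ijk}+\Delta_{kij}+\Delta_{kji}=0\qquad\text{for all }0\le i,j,k\le p$$ if and only if $1-3\beta=0$ and $2\beta-\alpha=0$, i.e. if and only if $\alpha=2/3$ and $\beta=1/3$.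 In that case the right-hand side of the discrete entropy equation in (a) vanishes whatever the values of the coefficients $u_i$, and, if $f^*$ is entropy stable in the sense of Tadmor, the DG scheme is entropy stable.
   Context: Let $\Omega=[-1,1]$, let $\Gamma=\partial\Omega=\{-1,1\}$ with outward normal $\hat n$ (so $\hat n(\pm1)=\pm1$ and $\int_\Gamma g\,\hat n\,d\Gamma=g(1)-g(-1)$), let $\mathcal{P}^m$ be the space of polynomials of degree at most $m$, and let $L_i$ be the $i$th Legendre polynomial. A collocation projection $\Pi$ with values in $\mathcal{P}^q$ is the interpolation operator at $q+1$ distinct nodes in $\Omega$: $\Pi(f)$ is the unique element of $\mathcal{P}^q$ agreeing with $f$ at the nodes. Given the polynomial degree $p$, $\Pi$ is called valid if (1) its nodes are symmetrically distributed in $\Omega$ (about $0$), and (2) the nodes induce a quadrature rule of strength $\tau\ge 2p-1$ on $\Omega$, i.e. $\int_\Omega f\,d\Omega=\int_\Omega\Pi(f)\,d\Omega$ for all $f\in\mathcal{P}^\tau$. For $0\le i,j,k\le p$ and real $\alpha,\beta$ with $\alpha+\beta=1$ the aliasing error tensor is $$\Delta_{ijk}(\alpha,\beta):=\int_\Omega \frac{dL_k}{dx}L_iL_j\,d\Omega-\beta\int_\Gamma L_iL_jL_k\,\hat n\,d\Gamma+\int_\Omega\Bigl(\beta\frac{dL_i}{dx}\Pi(L_jL_k)+\beta\frac{dL_j}{dx}\Pi(L_iL_k)-\alpha\frac{dL_k}{dx}\Pi(L_iL_j)\Bigr)d\Omega .$$ The split form DG semi-discretization of the Burgers equation $\partial_t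 u+\frac12\partial_x(u^2)=0$ on the element $\Omega$, with splitting coefficients $\alpha,\beta$ and numerical flux $f^*$ (a value at each point of $\Gamma$ and each time), is: $u(\cdot,t)\in\mathcal{P}^p$ with coefficients differentiable in $t$, and for every time-independent $\phi\in\mathcal{P}^p$, $$\int_\Omega\frac{d}{dt}\Pi(\phi u)\,d\Omega-\frac{\alpha}{2}\int_\Omega\frac{d\phi}{dx}\Pi(u^2)\,d\Omega+\beta\int_\Omega\frac{du}{dx}\Pi(\phi u)\,d\Omega-\frac{\beta}{2}\int_\Gamma\phi u^2\,\hat n\,d\Gamma+\int_\Gamma\phi f^*\,\hat n\,d\Gamma=0 .$$ The discrete entropy is $\frac12\sum_{k=0}^p u_k^2\int_\Omega\Pi(L_k^2)\,d\Omega$. The numerical flux is entropy stable in the sense of Tadmor (for the quadratic entropy $u^2/2$) if at each interface with left and right states $u_L,u_R$ one has $(u_R-u_L)f^*-\frac16(u_R^3-u_L^3)\le 0$. The scheme is (locally) entropy stable if, with such a flux, the discrete entropy of an element changes only through the surface term $\int_\Gamma(\frac16u^3-uf^* )\hat n\,d\Gamma$, i.e. the right-hand side of the discrete entropy equation is zero for all values of the coefficients $u_i$.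
   Formalization: The "only if" in (c) fails for projections without aliasing (p=0, or p=1 with two Gauss nodes); for a fixed Π it is stated when some v in P^p has ∫v'Π(v²) ≠ ∫v'v², and also, for p ≥ 1, with the relation required for all valid Π. The "if" part holds for every valid Π. *)

theory Defs
  imports "HOL-Analysis.Analysis" "HOL-Computational_Algebra.Polynomial"
begin

text \<open>The element is \<open>{-1..1}\<close>; its boundary integral carries the outward normal \<open>\<plusminus>1\<close> at \<open>\<plusminus>1\<close>.\<close>

definition vol_int :: "(real \<Rightarrow> real) \<Rightarrow> real" where
  "vol_int g = integral {-1..1} g"

definition bnd_int :: "(real \<Rightarrow> real) \<Rightarrow> real" where
  "bnd_int g = g 1 - g (-1)"

text \<open>Rodrigues' formula, normalised by \<open>L\<^sub>n(1) = 1\<close>.\<close>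

definition legendre :: "nat \<Rightarrow> real poly" where
  "legendre n = smult (1 / (2 ^ n * fact n)) ((pderiv ^^ n) ([:-1, 0, 1:] ^ n))"

definition collocation :: "nat \<Rightarrow> real set \<Rightarrow> (real \<Rightarrow> real) \<Rightarrow> real poly" where
  "collocation q X f = (THE g. degree g \<le> q \<and> (\<forall>x\<in>X. poly g x = f x))"

definition quadrature_strength :: "((real \<Rightarrow> real) \<Rightarrow> real poly) \<Rightarrow> nat \<Rightarrow> bool" where
  "quadrature_strength P \<tau> \<longleftrightarrow>
     (\<forall>f::real poly. degree f \<le> \<tau> \<longrightarrow> vol_int (poly f) = vol_int (poly (P (poly f))))"

text \<open>The bound \<open>\<tau> \<ge> 2p - 1\<close> is written without natural-number subtraction. The degree \<open>q\<close> of the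
  interpolation is not tied to \<open>p\<close>.\<close>

definition valid_collocation :: "nat \<Rightarrow> ((real \<Rightarrow> real) \<Rightarrow> real poly) \<Rightarrow> bool" where
  "valid_collocation p P \<longleftrightarrow>
     (\<exists>q X \<tau>. finite X \<and> card X = q + 1 \<and> X \<subseteq> {-1..1} \<and> P = collocation q X \<and>
        uminus ` X = X \<and> \<tau> + 1 \<ge> 2 * p \<and> quadrature_strength P \<tau>)"

definition aliasing_tensor ::
    "((real \<Rightarrow> real) \<Rightarrow> real poly) \<Rightarrow> real \<Rightarrow> real \<Rightarrow> nat \<Rightarrow> nat \<Rightarrow> nat \<Rightarrow> real" where
  "aliasing_tensor P \<alpha> \<beta> i j k =
     (let L = legendre; \<Pi>L = (\<lambda>m n. P (poly (L m * L n))) in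
      vol_int (\<lambda>x. poly (pderiv (L k)) x * poly (L i) x * poly (L j) x)
      - \<beta> * bnd_int (\<lambda>x. poly (L i) x * poly (L j) x * poly (L k) x)
      + vol_int (\<lambda>x. \<beta> * poly (pderiv (L i)) x * poly (\<Pi>L j k) x
                    + \<beta> * poly (pderiv (L j)) x * poly (\<Pi>L i k) x
                    - \<alpha> * poly (pderiv (L k)) x * poly (\<Pi>L i j) x))"

definition skew_symmetric ::
    "nat \<Rightarrow> ((real \<Rightarrow> real) \<Rightarrow> real poly) \<Rightarrow> real \<Rightarrow> real \<Rightarrow> bool" where
  "skew_symmetric p P \<alpha> \<beta> \<longleftrightarrow>
     (\<forall>i\<le>p. \<forall>j\<le>p. \<forall>k\<le>p.
        aliasing_tensor P \<alpha> \<beta> i j k + aliasing_tensor P \<alpha> \<beta> k i j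
          + aliasing_tensor P \<alpha> \<beta> k j i = 0)"

text \<open>If \<open>\<alpha> + \<beta> = 1\<close> and the projection evaluates \<open>\<integral> v' v\<^sup>2\<close> exactly for all \<open>v\<close> of degree at most \<open>p\<close>,
  then the skew-symmetry relation holds for every splitting. Examples are \<open>p = 0\<close> and Gauss nodes
  with \<open>p = q = 1\<close>.\<close>

definition has_aliasing :: "nat \<Rightarrow> ((real \<Rightarrow> real) \<Rightarrow> real poly) \<Rightarrow> bool" where
  "has_aliasing p P \<longleftrightarrow>
     (\<exists>v::real poly. degree v \<le> p \<and>
        vol_int (\<lambda>x. poly (pderiv v) x * poly (P (poly (v ^ 2))) x)
          \<noteq> vol_int (\<lambda>x. poly (pderiv v) x * poly (v ^ 2) x))"

definition legendre_sum :: "nat \<Rightarrow> (nat \<Rightarrow> real \<Rightarrow> real) \<Rightarrow> real \<Rightarrow> real poly" where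
  "legendre_sum p c t = (\<Sum>k\<le>p. smult (c k t) (legendre k))"

definition time_interval :: "real set \<Rightarrow> bool" where
  "time_interval T \<longleftrightarrow> is_interval T \<and> (\<exists>a\<in>T. \<exists>b\<in>T. a < b)"

text \<open>\<open>c k t\<close> is the \<open>k\<close>th Legendre coefficient at time \<open>t\<close>, and \<open>fs x t\<close> the value of the numerical
  flux at the boundary point \<open>x\<close> and time \<open>t\<close>. Time derivatives are one-sided at end points of \<open>T\<close>.\<close>

definition split_form_solution ::
    "nat \<Rightarrow> ((real \<Rightarrow> real) \<Rightarrow> real poly) \<Rightarrow> real \<Rightarrow> real \<Rightarrow> real set
      \<Rightarrow> (real \<Rightarrow> real \<Rightarrow> real) \<Rightarrow> (nat \<Rightarrow> real \<Rightarrow> real) \<Rightarrow> bool" where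
  "split_form_solution p P \<alpha> \<beta> T fs c \<longleftrightarrow>
     (\<forall>k\<le>p. \<forall>t\<in>T. c k differentiable (at t within T)) \<and>
     (let u = legendre_sum p c in
      \<forall>t\<in>T. \<forall>\<phi>. degree \<phi> \<le> p \<longrightarrow>
        vol_int (\<lambda>x. vector_derivative (\<lambda>s. poly (P (poly (\<phi> * u s))) x) (at t within T))
        - \<alpha> / 2 * vol_int (\<lambda>x. poly (pderiv \<phi>) x * poly (P (poly (u t ^ 2))) x)
        + \<beta> * vol_int (\<lambda>x. poly (pderiv (u t)) x * poly (P (poly (\<phi> * u t))) x)
        - \<beta> / 2 * bnd_int (\<lambda>x. poly \<phi> x * poly (u t) x ^ 2)
        + bnd_int (\<lambda>x. poly \<phi> x * fs x t) = 0)"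

definition discrete_entropy ::
    "nat \<Rightarrow> ((real \<Rightarrow> real) \<Rightarrow> real poly) \<Rightarrow> (nat \<Rightarrow> real \<Rightarrow> real) \<Rightarrow> real \<Rightarrow> real" where
  "discrete_entropy p P c t =
     1 / 2 * (\<Sum>k\<le>p. (c k t)^2 * vol_int (poly (P (poly (legendre k ^ 2)))))"

definition surface_term ::
    "nat \<Rightarrow> (real \<Rightarrow> real \<Rightarrow> real) \<Rightarrow> (nat \<Rightarrow> real \<Rightarrow> real) \<Rightarrow> real \<Rightarrow> real" where
  "surface_term p fs c t =
     bnd_int (\<lambda>x. 1 / 6 * poly (legendre_sum p c t) x ^ 3 - poly (legendre_sum p c t) x * fs x t)"

definition entropy_rhs ::
    "nat \<Rightarrow> ((real \<Rightarrow> real) \<Rightarrow> real poly) \<Rightarrow> real \<Rightarrow> real \<Rightarrow> (nat \<Rightarrow> real) \<Rightarrow> real" where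
  "entropy_rhs p P \<alpha> \<beta> a =
     - (1 / 2) * (\<Sum>i\<le>p. \<Sum>j\<le>p. \<Sum>k\<le>p. a i * a j * a k * aliasing_tensor P \<alpha> \<beta> i j k)"

definition tadmor_stable :: "real \<Rightarrow> real \<Rightarrow> real \<Rightarrow> bool" where
  "tadmor_stable uL uR f \<longleftrightarrow> (uR - uL) * f - 1 / 6 * (uR ^ 3 - uL ^ 3) \<le> 0"

text \<open>\<open>w (-1) t\<close> and \<open>w 1 t\<close> are the states of the left and right neighbours at the two interfaces
  of the element.\<close>

definition entropy_stable_flux ::
    "nat \<Rightarrow> real set \<Rightarrow> (real \<Rightarrow> real \<Rightarrow> real) \<Rightarrow> (real \<Rightarrow> real \<Rightarrow> real) \<Rightarrow> (nat \<Rightarrow> real \<Rightarrow> real) \<Rightarrow> bool"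
  where
  "entropy_stable_flux p T w fs c \<longleftrightarrow>
     (\<forall>t\<in>T. tadmor_stable (w (-1) t) (poly (legendre_sum p c t) (-1)) (fs (-1) t) \<and>
            tadmor_stable (poly (legendre_sum p c t) 1) (w 1 t) (fs 1 t))"

definition entropy_stable_scheme ::
    "nat \<Rightarrow> ((real \<Rightarrow> real) \<Rightarrow> real poly) \<Rightarrow> real \<Rightarrow> real \<Rightarrow> bool" where
  "entropy_stable_scheme p P \<alpha> \<beta> \<longleftrightarrow>
     (\<forall>a. entropy_rhs p P \<alpha> \<beta> a = 0) \<and>
     (\<forall>T w fs c. time_interval T \<longrightarrow> split_form_solution p P \<alpha> \<beta> T fs c \<longrightarrow>
        entropy_stable_flux p T w fs c \<longrightarrow>
        (\<forall>t\<in>T. (discrete_entropy p P c has_real_derivative surface_term p fs c t) (at t within T)))"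

end

theory Submission
  imports Defs
begin

text \<open>The sum of the three tensors with cyclically chosen last index contains
  \<open>L\<^sub>i\<close>, \<open>L\<^sub>j\<close>, \<open>L\<^sub>k\<close> symmetrically, so the exact volume integrals combine to the
  boundary term \<open>B = \<integral> (L\<^sub>i L\<^sub>j L\<^sub>k)'\<close> and the sum is \<open>(1 - 3\<beta>) B + (2\<beta> - \<alpha>) K\<close>, where \<open>K\<close> collects the
  projected products. As \<open>2\<beta> - \<alpha> = 3\<beta> - 1\<close>, it vanishes iff \<open>\<beta> = 1/3\<close> or \<open>B = K\<close>, and \<open>B \<noteq> K\<close> for
  some indices iff there is aliasing. The entropy equation is the scheme tested with \<open>\<phi> = u\<close>: strength
  \<open>2p - 1\<close> makes \<open>\<integral> \<Pi>(L\<^sub>i L\<^sub>j)\<close> exact, hence zero, for \<open>i \<noteq> j\<close>, so that the time derivative term is that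
  of the discrete entropy.\<close>

section \<open>Integration of polynomials\<close>

text \<open>As a functional on polynomials the integral is linear without integrability side
  conditions.\<close>

definition poly_int :: "real poly \<Rightarrow> real" where
  "poly_int f = vol_int (poly f)"

lemma poly_integrable: "poly (f :: real poly) integrable_on {-1..1}"
  by (intro integrable_continuous_real continuous_intros)

lemma poly_int_add: "poly_int (f + g) = poly_int f + poly_int g"
  using integral_add[OF poly_integrable poly_integrable, of f g]
  by (simp add: poly_int_def vol_int_def flip: poly_add)

lemma poly_int_smult: "poly_int (smult c f) = c * poly_int f"
proof -
  have "poly (smult c f) = (\<lambda>x. c * poly f x)" by auto
  then show ?thesis by (simp add: poly_int_def vol_int_def)
qed

lemma poly_int_0 [simp]: "poly_int 0 = 0"
  using poly_int_smult[of 0 0] by simp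

lemma poly_int_diff: "poly_int (f - g) = poly_int f - poly_int g"
  using poly_int_add[of "f - g" g] by simp

lemma poly_int_sum: "poly_int (sum f A) = (\<Sum>i\<in>A. poly_int (f i))"
  by (induction A rule: infinite_finite_induct) (simp_all add: poly_int_add)

lemma poly_int_pderiv: "poly_int (pderiv f) = poly f 1 - poly f (-1)"
proof -
  have "(poly (pderiv f) has_integral poly f 1 - poly f (-1)) {-1..1}"
    by (rule fundamental_theorem_of_calculus)
       (auto intro!: has_field_derivative_at_within[OF poly_DERIV]
             simp flip: has_real_derivative_iff_has_vector_derivative)
  then show ?thesis
    by (simp add: poly_int_def vol_int_def integral_unique)
qed

lemma poly_int_by_parts:
  "poly_int (f * pderiv g) = poly (f * g) 1 - poly (f * g) (-1) - poly_int (pderiv f * g)"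
  using poly_int_pderiv[of "f * g"] by (simp add: pderiv_mult poly_int_add mult.commute)

section \<open>Legendre polynomials\<close>

text \<open>By the product rule each derivative costs at most one factor \<open>q\<close>. With
  \<open>q = x^2 - 1\<close> this makes the boundary terms of the repeated integration by parts
  vanish.\<close>

lemma power_dvd_pderiv:
  fixes q f :: "real poly"
  assumes "q ^ Suc k dvd f"
  shows "q ^ k dvd pderiv f"
proof -
  obtain h where "f = q ^ Suc k * h"
    using assms by (elim dvdE)
  then have "pderiv f = q ^ k * (q * pderiv h + smult (of_nat (Suc k)) (pderiv q * h))"
    by (simp add: pderiv_mult pderiv_power_Suc algebra_simps del: power_Suc of_nat_Suc)
       (simp add: algebra_simps)
  then show ?thesis by simp
qed

lemma power_dvd_higher_pderiv:
  fixes q :: "real poly"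
  assumes "m \<le> n"
  shows "q ^ (n - m) dvd (pderiv ^^ m) (q ^ n)"
  using assms
proof (induction m)
  case (Suc m)
  then have "q ^ Suc (n - Suc m) dvd (pderiv ^^ m) (q ^ n)"
    by (simp add: Suc_diff_Suc del: power_Suc)
  then show ?case
    using power_dvd_pderiv by simp
qed simp

lemma higher_pderiv_boundary:
  assumes "m < n" "x = 1 \<or> x = - 1"
  shows "poly ((pderiv ^^ m) ([:-1, 0, 1:] ^ n)) x = (0::real)"
proof -
  obtain h where "(pderiv ^^ m) ([:-1, 0, 1:] ^ n) = [:-1, 0, 1:] ^ (n - m) * (h :: real poly)"
    using power_dvd_higher_pderiv[of m n "[:-1, 0, 1:]"] assms by (auto elim: dvdE)
  then show ?thesis
    using assms by auto
qed

text \<open>Integration by parts moves one derivative after another onto \<open>g\<close>, until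
  \<open>g\<close> becomes zero. The boundary terms vanish because fewer than \<open>n\<close>
  derivatives remain on \<open>(x^2 - 1)^n\<close>. The exponent \<open>n\<close> stays fixed while
  \<open>m\<close> decreases, so the two are kept apart.\<close>

lemma rodrigues_orthogonal:
  assumes "m \<le> n" "degree g < m"
  shows "poly_int (g * (pderiv ^^ m) ([:-1, 0, 1:] ^ n)) = 0"
  using assms
proof (induction m arbitrary: g)
  case (Suc m)
  let ?h = "(pderiv ^^ m) ([:-1, 0, 1:] ^ n)"
  \<comment> \<open>A constant \<open>g\<close> is treated apart: its derivative again has degree 0,
    which is not below \<open>m\<close> for \<open>m = 0\<close>.\<close>
  have "poly_int (pderiv g * ?h) = 0"
  proof (cases "degree g = 0")
    case True
    then have "pderiv g = 0" by (simp only: pderiv_eq_0_iff)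
    then show ?thesis by simp
  next
    case False
    then show ?thesis using Suc by (simp add: degree_pderiv)
  qed
  then show ?case
    using Suc.prems by (simp add: poly_int_by_parts higher_pderiv_boundary)
qed simp

lemma legendre_orthogonal_lower: "degree g < n \<Longrightarrow> poly_int (g * legendre n) = 0"
  by (simp add: legendre_def poly_int_smult rodrigues_orthogonal)

lemma degree_legendre [simp]: "degree (legendre n) = n"
  by (simp add: legendre_def degree_higher_pderiv degree_power_eq)

lemma legendre_orthogonal: "i \<noteq> j \<Longrightarrow> poly_int (legendre i * legendre j) = 0"
  using legendre_orthogonal_lower[of "legendre i" j] legendre_orthogonal_lower[of "legendre j" i]
  by (cases "i < j") (auto simp: mult.commute)

lemma legendre_nonzero: "legendre n \<noteq> 0"
proof (cases n)
  case 0
  then show ?thesis by (simp add: legendre_def)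
next
  case (Suc m)
  then show ?thesis using degree_legendre[of n] by (metis degree_0 nat.distinct(1))
qed

lemma legendre_expansion:
  assumes "degree v \<le> p"
  shows "\<exists>a. v = (\<Sum>k\<le>p. smult (a k) (legendre k))"
  using assms
proof (induction p arbitrary: v)
  case 0
  then have "degree v = 0" by simp
  then obtain c where "v = [:c:]" by (rule degree_eq_zeroE)
  then show ?case by (intro exI[of _ "\<lambda>_. c"]) (simp add: legendre_def)
next
  case (Suc p)
  \<comment> \<open>With this factor the coefficients of degree \<open>Suc p\<close> cancel. The
    degree of \<open>v\<close> may be smaller, hence \<open>coeff v (Suc p)\<close> instead of its
    leading coefficient.\<close>
  define r where "r = coeff v (Suc p) / lead_coeff (legendre (Suc p))"
  have "degree (v - smult r (legendre (Suc p))) \<le> p"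
  proof (rule degree_le, intro allI impI)
    fix i assume "p < i"
    then consider "i = Suc p" | "i > Suc p" by linarith
    then show "coeff (v - smult r (legendre (Suc p))) i = 0"
    proof cases
      case 1
      then show ?thesis
        using legendre_nonzero[of "Suc p"] leading_coeff_neq_0[of "legendre (Suc p)"]
        by (simp add: r_def)
    next
      case 2
      then show ?thesis using Suc.prems by (simp add: coeff_eq_0)
    qed
  qed
  then obtain a where "v - smult r (legendre (Suc p)) = (\<Sum>k\<le>p. smult (a k) (legendre k))"
    using Suc.IH by blast
  then show ?case
    by (intro exI[of _ "a(Suc p := r)"]) (simp add: diff_eq_eq)
qed

section \<open>Interpolation\<close>

lemma degree_prod_linear: "degree (\<Prod>y\<in>X. [:- y, 1:]) = card X" for X :: "real set"
  by (subst degree_prod_sum_eq) auto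

lemma poly_prod_linear_eq_0_iff:
  "finite X \<Longrightarrow> poly (\<Prod>y\<in>X. [:- y, 1:]) x = 0 \<longleftrightarrow> x \<in> X" for x :: real
  by (auto simp: poly_prod)

text \<open>Newton's scheme: the value at a new node is corrected by a multiple of the nodal
  polynomial \<open>w\<close> of the old nodes, which leaves the old values unchanged.\<close>

lemma interpolation_exists:
  fixes f :: "real \<Rightarrow> real"
  assumes "finite X"
  shows "\<exists>g. degree g \<le> card X - 1 \<and> (\<forall>x\<in>X. poly g x = f x)"
  using assms
proof (induction X rule: finite_induct)
  case empty
  show ?case by (intro exI[of _ 0]) simp
next
  case (insert a X)
  then obtain g where g: "degree g \<le> card X - 1" "\<forall>x\<in>X. poly g x = f x"
    by blast
  define w where "w = (\<Prod>y\<in>X. [:- y, 1:])"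
  have "poly w a \<noteq> 0"
    using insert by (simp add: w_def poly_prod_linear_eq_0_iff)
  moreover have "\<forall>x\<in>X. poly w x = 0"
    using insert by (simp add: w_def poly_prod_linear_eq_0_iff)
  moreover have "degree (g + smult ((f a - poly g a) / poly w a) w) \<le> card X"
    using g by (intro degree_add_le) (auto simp: w_def degree_prod_linear)
  ultimately show ?case
    using insert g by (intro exI[of _ "g + smult ((f a - poly g a) / poly w a) w"]) simp
qed

lemma interpolation_unique:
  fixes g h :: "real poly"
  assumes "card X = q + 1" "degree g \<le> q" "degree h \<le> q" "\<And>x. x \<in> X \<Longrightarrow> poly g x = poly h x"
  shows "g = h"
  using assms by (intro poly_eqI_degree[of X]) auto

text \<open>Replaces the definite description in \<open>collocation\<close>: a projection is
  computed by exhibiting a candidate with the right degree and nodal values.\<close>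

lemma collocation_eqI:
  assumes "card X = q + 1" "degree g \<le> q" "\<And>x. x \<in> X \<Longrightarrow> poly g x = f x"
  shows "collocation q X f = g"
  unfolding collocation_def
proof (rule the_equality)
  show "h = g" if "degree h \<le> q \<and> (\<forall>x\<in>X. poly h x = f x)" for h
    using that assms by (intro interpolation_unique[of X q]) auto
qed (use assms in auto)

lemma
  assumes "card X = q + 1"
  shows degree_collocation: "degree (collocation q X f) \<le> q"
    and poly_collocation: "x \<in> X \<Longrightarrow> poly (collocation q X f) x = f x"
proof -
  \<comment> \<open>An infinite set has cardinality 0, which is not \<open>q + 1\<close>.\<close>
  have "finite X" using assms by (metis add_is_0 card.infinite zero_neq_one)
  then obtain g where g: "degree g \<le> q" "\<forall>x\<in>X. poly g x = f x"
    using interpolation_exists[of X f] assms by auto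
  then have "collocation q X f = g"
    using assms by (intro collocation_eqI) auto
  with g show "degree (collocation q X f) \<le> q"
    "x \<in> X \<Longrightarrow> poly (collocation q X f) x = f x" by auto
qed

text \<open>The sum of the interpolants has the degree and the nodal values required of the
  interpolant of the sum, so uniqueness applies.\<close>

lemma valid_collocation_add:
  assumes "valid_collocation p P"
  shows "P (poly (f + g)) = P (poly f) + P (poly g)"
  using assms unfolding valid_collocation_def
  by (auto intro!: collocation_eqI degree_add_le simp: degree_collocation poly_collocation)

lemma valid_collocation_smult:
  assumes "valid_collocation p P"
  shows "P (poly (smult c f)) = smult c (P (poly f))"
  using assms unfolding valid_collocation_def
  by (auto intro!: collocation_eqI order_trans[OF degree_smult_le]
      simp: degree_collocation poly_collocation)

lemma valid_collocation_sum:
  assumes "valid_collocation p P"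
  shows "P (poly (\<Sum>i\<in>A. smult (a i) (f i))) = (\<Sum>i\<in>A. smult (a i) (P (poly (f i))))"
proof (induction A rule: infinite_finite_induct)
  \<comment> \<open>A sum over an infinite set is 0 by convention, so the infinite and the empty
    case both come down to this.\<close>
  have "P (poly 0) = 0"
    using valid_collocation_smult[OF assms, of 0 0] by simp
  then show "P (poly (\<Sum>i\<in>{}. smult (a i) (f i))) = (\<Sum>i\<in>{}. smult (a i) (P (poly (f i))))"
    "\<And>A. infinite A \<Longrightarrow>
      P (poly (\<Sum>i\<in>A. smult (a i) (f i))) = (\<Sum>i\<in>A. smult (a i) (P (poly (f i))))"
    by simp_all
qed (simp add: valid_collocation_add[OF assms] valid_collocation_smult[OF assms]
       del: poly_add poly_smult)

lemma valid_collocation_quadrature: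
  assumes "valid_collocation p P" "degree f + 1 \<le> 2 * p"
  shows "poly_int (P (poly f)) = poly_int f"
  using assms unfolding valid_collocation_def quadrature_strength_def poly_int_def by force

text \<open>Distinct indices up to \<open>p\<close> add up to at most \<open>2p - 1\<close>, just
  the degree for which the quadrature is exact.\<close>

lemma valid_collocation_orthogonal:
  assumes "valid_collocation p P" "i \<le> p" "j \<le> p" "i \<noteq> j"
  shows "poly_int (P (poly (legendre i * legendre j))) = 0"
proof -
  have "degree (legendre i * legendre j) + 1 \<le> 2 * p"
    using assms by (simp add: degree_mult_eq legendre_nonzero)
  then show ?thesis
    using assms by (simp add: valid_collocation_quadrature legendre_orthogonal)
qed

section \<open>The aliasing tensor\<close>

text \<open>Bridge from the pointwise integrands of the definitions to integrals of
  polynomials.\<close>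

lemma vol_int_eq_poly_int: "(\<And>x. g x = poly f x) \<Longrightarrow> vol_int g = poly_int f"
  unfolding poly_int_def by (rule arg_cong[of _ _ vol_int]) auto

lemma linear_sum_smult:
  fixes F :: "real poly \<Rightarrow> real"
  assumes "\<And>f g. F (f + g) = F f + F g" and "\<And>c f. F (smult c f) = c * F f"
  shows "F (\<Sum>i\<in>A. smult (a i) (f i)) = (\<Sum>i\<in>A. a i * F (f i))"
  using assms(2)[of 0 0]
  by (induction A rule: infinite_finite_induct) (simp_all add: assms)

lemma trilinear_sum_smult:
  fixes F :: "real poly \<Rightarrow> real poly \<Rightarrow> real poly \<Rightarrow> real"
  assumes "\<And>f f' g h. F (f + f') g h = F f g h + F f' g h"
    and "\<And>c f g h. F (smult c f) g h = c * F f g h"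
    and "\<And>f g g' h. F f (g + g') h = F f g h + F f g' h"
    and "\<And>c f g h. F f (smult c g) h = c * F f g h"
    and "\<And>f g h h'. F f g (h + h') = F f g h + F f g h'"
    and "\<And>c f g h. F f g (smult c h) = c * F f g h"
  shows "F (\<Sum>i\<in>A. smult (a i) (f i)) (\<Sum>i\<in>A. smult (a i) (f i)) (\<Sum>i\<in>A. smult (a i) (f i))
    = (\<Sum>i\<in>A. \<Sum>j\<in>A. \<Sum>k\<in>A. a i * a j * a k * F (f i) (f j) (f k))"
  unfolding linear_sum_smult[of "\<lambda>x. F x _ _", OF assms(1,2)]
  unfolding linear_sum_smult[of "\<lambda>x. F _ x _", OF assms(3,4)]
  unfolding linear_sum_smult[of "\<lambda>x. F _ _ x", OF assms(5,6)]
  by (simp add: sum_distrib_left mult.assoc)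

text \<open>The tensor extended from Legendre polynomials to arbitrary arguments, with the boundary
  term written as the integral of a derivative. Identities can then be proved once and evaluated at
  the solution itself.\<close>

definition aliasing_form ::
    "((real \<Rightarrow> real) \<Rightarrow> real poly) \<Rightarrow> real \<Rightarrow> real \<Rightarrow> real poly \<Rightarrow> real poly \<Rightarrow> real poly \<Rightarrow> real"
  where
  "aliasing_form P \<alpha> \<beta> f g h =
     poly_int (pderiv h * f * g) - \<beta> * poly_int (pderiv (f * g * h))
     + (\<beta> * poly_int (pderiv f * P (poly (g * h)))
        + \<beta> * poly_int (pderiv g * P (poly (f * h)))
        - \<alpha> * poly_int (pderiv h * P (poly (f * g))))"

lemma aliasing_tensor_eq_form:
  "aliasing_tensor P \<alpha> \<beta> i j k = aliasing_form P \<alpha> \<beta> (legendre i) (legendre j) (legendre k)"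
proof -
  have "vol_int (\<lambda>x. \<beta> * poly (pderiv f) x * poly a x + \<beta> * poly (pderiv g) x * poly b x
      - \<alpha> * poly (pderiv h) x * poly c x)
    = poly_int (smult \<beta> (pderiv f * a) + smult \<beta> (pderiv g * b) - smult \<alpha> (pderiv h * c))"
    for f g h a b c
    by (rule vol_int_eq_poly_int) simp
  moreover have "vol_int (\<lambda>x. poly (pderiv h) x * poly f x * poly g x) = poly_int (pderiv h * f * g)"
    for f g h
    by (rule vol_int_eq_poly_int) simp
  ultimately show ?thesis
    by (simp only: aliasing_tensor_def aliasing_form_def Let_def poly_int_add poly_int_diff
        poly_int_smult poly_int_pderiv[of "_ * _"] bnd_int_def poly_mult)
qed

lemma poly_int_pderiv_mult3:
  "poly_int (pderiv (f * g * h))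
    = poly_int (pderiv h * f * g) + poly_int (pderiv g * h * f) + poly_int (pderiv f * h * g)"
  unfolding poly_int_add[symmetric] by (simp add: pderiv_mult algebra_simps)

text \<open>Each of the three factors stands in the last slot once. Hence the exact integrals add up
  by the product rule, and each projected integral occurs twice with factor \<beta> and once with
  factor -\<alpha>.\<close>

lemma aliasing_form_cyclic_sum:
  "aliasing_form P \<alpha> \<beta> f g h + aliasing_form P \<alpha> \<beta> h f g + aliasing_form P \<alpha> \<beta> h g f
    = (1 - 3 * \<beta>) * poly_int (pderiv (f * g * h))
      + (2 * \<beta> - \<alpha>) * (poly_int (pderiv f * P (poly (g * h)))
          + poly_int (pderiv g * P (poly (f * h))) + poly_int (pderiv h * P (poly (f * g))))"
proof -
  \<comment> \<open>Products are brought into one order so that equal arguments of \<open>P\<close>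
    become syntactically equal.\<close>
  have "h * f * g = f * g * h" "h * g * f = f * g * h" "h * f = f * h" "h * g = g * h" "g * f = f * g"
    by (simp_all add: mult_ac)
  then show ?thesis
    unfolding aliasing_form_def using poly_int_pderiv_mult3[of f g h]
    by (simp add: algebra_simps del: poly_mult)
qed

text \<open>Linearity of the interpolation makes the form trilinear, so contracting the tensor with
  the coefficients of \<open>u\<close> evaluates the form on the diagonal.\<close>

lemma aliasing_form_sum:
  assumes "valid_collocation p P" and "u = (\<Sum>i\<in>A. smult (a i) (legendre i))"
  shows "(\<Sum>i\<in>A. \<Sum>j\<in>A. \<Sum>k\<in>A. a i * a j * a k * aliasing_tensor P \<alpha> \<beta> i j k)
    = aliasing_form P \<alpha> \<beta> u u u"
  unfolding aliasing_tensor_eq_form assms(2)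
  by (rule trilinear_sum_smult[symmetric])
     (simp_all add: aliasing_form_def valid_collocation_add[OF assms(1)]
       valid_collocation_smult[OF assms(1)] pderiv_add pderiv_smult distrib_left distrib_right
       poly_int_add poly_int_smult right_diff_distrib del: poly_add poly_smult poly_mult)

text \<open>For equal arguments the cyclic sum is three times the form.\<close>

lemma aliasing_form_diagonal:
  "aliasing_form P \<alpha> \<beta> u u u = (1 / 3 - \<beta>) * poly_int (pderiv (u ^ 3))
    + (2 * \<beta> - \<alpha>) * poly_int (pderiv u * P (poly (u ^ 2)))"
  using aliasing_form_cyclic_sum[of P \<alpha> \<beta> u u u]
  by (simp add: power3_eq_cube power2_eq_square algebra_simps del: poly_mult)

section \<open>The discrete entropy equation\<close>

text \<open>A connected set with more than one point has no isolated points. This makes the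
  derivative within \<open>T\<close> unique, so that \<open>vector_derivative\<close> can be
  evaluated.\<close>

lemma time_interval_not_bot:
  assumes "time_interval T" "t \<in> T"
  shows "at t within T \<noteq> bot"
proof -
  have "connected T" "\<And>x. T \<noteq> {x}"
    using assms by (auto simp: time_interval_def is_interval_connected_1)
  then show ?thesis
    using connected_imp_perfect[of T t] assms by (simp add: trivial_limit_within)
qed

lemma entropy_mass_term:
  assumes "valid_collocation p P" "k \<le> p"
  shows "poly_int (P (poly (legendre_sum p c t * legendre k)))
    = c k t * poly_int (P (poly (legendre k ^ 2)))"
proof -
  have "poly_int (P (poly (legendre_sum p c t * legendre k)))
    = (\<Sum>i\<le>p. c i t * poly_int (P (poly (legendre i * legendre k))))"
    by (simp add: legendre_sum_def sum_distrib_right valid_collocation_sum[OF assms(1)]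
        poly_int_sum poly_int_smult del: poly_mult poly_smult)
  also have "\<dots> = c k t * poly_int (P (poly (legendre k * legendre k)))"
    using assms by (subst sum.remove[of _ k]) (auto simp: valid_collocation_orthogonal intro!: sum.neutral)
  finally show ?thesis by (simp add: power2_eq_square)
qed

lemma discrete_entropy_has_derivative:
  assumes valid: "valid_collocation p P" and T: "time_interval T" and t: "t \<in> T"
    and sol: "split_form_solution p P \<alpha> \<beta> T fs c"
  shows "(discrete_entropy p P c has_real_derivative
      surface_term p fs c t + entropy_rhs p P \<alpha> \<beta> (\<lambda>k. c k t)) (at t within T)"
proof -
  define L where "L = legendre"
  define u where "u = legendre_sum p c"
  define B where "B = poly_int (pderiv (u t ^ 3))"
  define K where "K = poly_int (pderiv (u t) * P (poly (u t ^ 2)))"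
  define F where "F = bnd_int (\<lambda>x. poly (u t) x * fs x t)"
  have "\<forall>k\<le>p. \<exists>D. (c k has_real_derivative D) (at t within T)"
    using sol t by (auto simp: split_form_solution_def real_differentiable_def)
  then obtain c' where c': "\<And>k. k \<le> p \<Longrightarrow> (c k has_real_derivative c' k) (at t within T)"
    by metis
  \<comment> \<open>As \<open>\<phi>\<close> is independent of time and \<open>P\<close> is linear,
    only the coefficients are differentiated.\<close>
  have pointwise: "vector_derivative (\<lambda>s. poly (P (poly (\<phi> * u s))) x) (at t within T)
      = poly (\<Sum>k\<le>p. smult (c' k) (P (poly (\<phi> * L k)))) x" for \<phi> x
  proof (rule vector_derivative_within[OF time_interval_not_bot[OF T t]])
    have "\<phi> * u s = (\<Sum>k\<le>p. smult (c k s) (\<phi> * L k))" for s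
      by (simp add: u_def L_def legendre_sum_def sum_distrib_left)
    then have "(\<lambda>s. poly (P (poly (\<phi> * u s))) x) = (\<lambda>s. \<Sum>k\<le>p. c k s * poly (P (poly (\<phi> * L k))) x)"
      by (simp add: valid_collocation_sum[OF valid] poly_sum del: poly_mult)
    moreover have "((\<lambda>s. \<Sum>k\<le>p. c k s * poly (P (poly (\<phi> * L k))) x) has_real_derivative
        (\<Sum>k\<le>p. c' k * poly (P (poly (\<phi> * L k))) x)) (at t within T)"
      by (auto intro!: derivative_eq_intros c')
    ultimately show "((\<lambda>s. poly (P (poly (\<phi> * u s))) x) has_vector_derivative
        poly (\<Sum>k\<le>p. smult (c' k) (P (poly (\<phi> * L k)))) x) (at t within T)"
      by (simp add: poly_sum flip: has_real_derivative_iff_has_vector_derivative)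
  qed
  \<comment> \<open>The test function \<open>u t\<close> is frozen at time \<open>t\<close>, so only
    the second factor is differentiated. This yields \<open>c' k * c k t\<close>, the derivative of
    half the square of \<open>c k\<close>.\<close>
  have "vol_int (\<lambda>x. vector_derivative (\<lambda>s. poly (P (poly (u t * u s))) x) (at t within T))
      = poly_int (\<Sum>k\<le>p. smult (c' k) (P (poly (u t * L k))))"
    using pointwise by (rule vol_int_eq_poly_int)
  also have "\<dots> = (\<Sum>k\<le>p. c' k * (c k t * poly_int (P (poly (L k ^ 2)))))"
    using entropy_mass_term[OF valid] by (simp add: poly_int_sum poly_int_smult u_def L_def)
  finally have mass:
    "vol_int (\<lambda>x. vector_derivative (\<lambda>s. poly (P (poly (u t * u s))) x) (at t within T))
      = (\<Sum>k\<le>p. c' k * (c k t * poly_int (P (poly (L k ^ 2)))))" .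
  have volume: "vol_int (\<lambda>x. poly (pderiv (u t)) x * poly (P (poly (u t ^ 2))) x) = K"
    unfolding K_def by (rule vol_int_eq_poly_int) simp
  have boundary: "bnd_int (\<lambda>x. poly (u t) x * poly (u t) x ^ 2) = B"
    by (simp add: B_def poly_int_pderiv bnd_int_def power2_eq_square power3_eq_cube)
  have "degree (u t) \<le> p"
    unfolding u_def legendre_sum_def
    by (intro degree_sum_le) (auto intro: order_trans[OF degree_smult_le])
  with sol t have "vol_int (\<lambda>x. vector_derivative (\<lambda>s. poly (P (poly (u t * u s))) x) (at t within T))
      - \<alpha> / 2 * vol_int (\<lambda>x. poly (pderiv (u t)) x * poly (P (poly (u t ^ 2))) x)
      + \<beta> * vol_int (\<lambda>x. poly (pderiv (u t)) x * poly (P (poly (u t * u t))) x)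
      - \<beta> / 2 * bnd_int (\<lambda>x. poly (u t) x * poly (u t) x ^ 2) + F = 0"
    unfolding split_form_solution_def Let_def u_def F_def by blast
  then have scheme: "(\<Sum>k\<le>p. c' k * (c k t * poly_int (P (poly (L k ^ 2)))))
      - \<alpha> / 2 * K + \<beta> * K - \<beta> / 2 * B + F = 0"
    unfolding mass power2_eq_square[of "u t", symmetric] volume boundary .
  have surface: "surface_term p fs c t = B / 6 - F"
    by (simp add: surface_term_def B_def F_def u_def poly_int_pderiv bnd_int_def diff_divide_distrib)
  have rhs: "entropy_rhs p P \<alpha> \<beta> (\<lambda>k. c k t) = - (1 / 2) * ((1 / 3 - \<beta>) * B + (2 * \<beta> - \<alpha>) * K)"
    unfolding entropy_rhs_def B_def K_def
    by (subst aliasing_form_sum[OF valid, of "u t"])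
       (simp_all add: u_def legendre_sum_def aliasing_form_diagonal)
  have "(discrete_entropy p P c has_real_derivative
      (\<Sum>k\<le>p. c' k * (c k t * poly_int (P (poly (L k ^ 2)))))) (at t within T)"
    unfolding discrete_entropy_def[abs_def] poly_int_def[symmetric] L_def
    by (auto intro!: derivative_eq_intros c' simp: sum_distrib_left mult_ac intro!: sum.cong)
  \<comment> \<open>The \<open>B / 6\<close> of the surface term cancels against the part
    \<open>- B / 6\<close> of the right-hand side; what remains is the scheme solved for the mass
    term.\<close>
  moreover have "(\<Sum>k\<le>p. c' k * (c k t * poly_int (P (poly (L k ^ 2)))))
      = surface_term p fs c t + entropy_rhs p P \<alpha> \<beta> (\<lambda>k. c k t)"
    using scheme unfolding surface rhs by (simp add: field_simps)
  ultimately show ?thesis by simp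
qed

section \<open>Aliasing\<close>

text \<open>Nodes are added in pairs \<open>a\<close>, \<open>- a\<close>, which multiplies the
  nodal polynomial by \<open>x^2 - a^2\<close>. Its integral is then a quadratic polynomial in
  \<open>a\<close>, so all but finitely many \<open>a\<close> keep it nonzero.\<close>

lemma symmetric_nodes_exist:
  "\<exists>X::real set. finite X \<and> card X = 2 * n \<and> X \<subseteq> {-1..1} \<and> uminus ` X = X \<and>
     poly_int (\<Prod>y\<in>X. [:- y, 1:]) \<noteq> 0"
proof (induction n)
  case 0
  have "poly_int 1 = 2"
    using poly_int_pderiv[of "[:0, 1:]"] by (simp add: pderiv_pCons one_pCons)
  then show ?case by (intro exI[of _ "{}"]) simp
next
  case (Suc n)
  then obtain X :: "real set" where X: "finite X" "card X = 2 * n" "X \<subseteq> {-1..1}" "uminus ` X = X"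
    and int_X: "poly_int (\<Prod>y\<in>X. [:- y, 1:]) \<noteq> 0"
    by blast
  define s where "s = (\<Prod>y\<in>X. [:- y, 1:])"
  \<comment> \<open>Besides the old nodes these are the \<open>a\<close> at which the new integral
    vanishes. The leading coefficient \<open>poly_int s\<close> is nonzero by the induction
    hypothesis, so there are finitely many.\<close>
  define bad where "bad = X \<union> {a. poly [:- poly_int ([:0, 0, 1:] * s), 0, poly_int s:] a = 0}"
  have "finite bad"
    using X int_X unfolding bad_def by (intro finite_UnI poly_roots_finite) (auto simp: s_def)
  then have "infinite ({0<..1} - bad)"
    by (simp add: Diff_infinite_finite infinite_Ioc)
  then obtain a where a: "0 < a" "a \<le> 1" "a \<notin> bad"
    by (metis Diff_iff ex_in_conv finite.emptyI greaterThanAtMost_iff)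
  then have "a \<notin> X" by (simp add: bad_def)
  moreover have "- a \<notin> X"
    using \<open>a \<notin> X\<close> X(4) by (metis image_eqI minus_minus)
  moreover have "a \<noteq> - a" using a by simp
  ultimately have new: "a \<notin> insert (- a) X" "- a \<notin> X" by auto
  have "(\<Prod>y\<in>insert a (insert (- a) X). [:- y, 1:]) = [:- a, 1:] * ([:a, 1:] * s)"
    using new X by (simp add: s_def del: mult_pCons_left)
  also have "\<dots> = [:0, 0, 1:] * s - smult (a ^ 2) s"
    by (simp add: algebra_simps power2_eq_square)
  finally have "poly_int (\<Prod>y\<in>insert a (insert (- a) X). [:- y, 1:])
      = poly_int ([:0, 0, 1:] * s) - a ^ 2 * poly_int s"
    by (simp only: poly_int_diff poly_int_smult)
  also have "\<dots> \<noteq> 0"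
    using a by (simp add: bad_def power2_eq_square algebra_simps)
  finally show ?case
    using X new a by (intro exI[of _ "insert a (insert (- a) X)"]) auto
qed

text \<open>Subtracting the nodal polynomial removes the leading term and does not affect the values
  at the nodes.\<close>

lemma collocation_of_monic:
  assumes "finite X" "card X = q + 1" "degree f = q + 1" "lead_coeff f = 1"
  shows "collocation q X (poly f) = f - (\<Prod>y\<in>X. [:- y, 1:])"
proof (rule collocation_eqI)
  let ?w = "\<Prod>y\<in>X. [:- y, 1:]"
  have w: "degree ?w = q + 1" "lead_coeff ?w = 1"
    using assms by (simp add: degree_prod_linear) (subst lead_coeff_prod, simp)
  show "degree (f - ?w) \<le> q"
  proof (rule degree_le, intro allI impI)
    fix i assume "q < i"
    then consider "i = q + 1" | "i > q + 1" by linarith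
    then show "coeff (f - ?w) i = 0"
      using assms w by cases (simp_all add: coeff_eq_0)
  qed
  show "poly (f - ?w) x = poly f x" if "x \<in> X" for x
    using that assms by (simp add: poly_prod_linear_eq_0_iff)
qed (use assms in simp)

text \<open>Interpolation at \<open>2p\<close> nodes has strength \<open>2p - 1\<close> for free, and it changes \<open>v\<^sup>2\<close>, for monic \<open>v\<close>
  of degree \<open>p\<close>, exactly by the nodal polynomial \<open>w\<close>. So aliasing occurs as soon as \<open>\<integral> v' w \<noteq> 0\<close>;
  since \<open>\<integral> w \<noteq> 0\<close>, this holds for \<open>v = x\<^sup>p\<close> or for \<open>v = x\<^sup>p + x\<close>.\<close>

lemma aliasing_collocation_exists:
  assumes "p \<ge> 1"
  shows "\<exists>Q. valid_collocation p Q \<and> has_aliasing p Q"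
proof -
  obtain X :: "real set" where X: "finite X" "card X = 2 * p" "X \<subseteq> {-1..1}" "uminus ` X = X"
    and int_X: "poly_int (\<Prod>y\<in>X. [:- y, 1:]) \<noteq> 0"
    using symmetric_nodes_exist[of p] by blast
  define q where "q = 2 * p - 1"
  have card: "card X = q + 1" using X assms by (simp add: q_def)
  define w where "w = (\<Prod>y\<in>X. [:- y, 1:])"
  define Q where "Q = collocation q X"
  have "quadrature_strength Q q"
    unfolding quadrature_strength_def Q_def using collocation_eqI[OF card] by simp
  then have "valid_collocation p Q"
    unfolding valid_collocation_def using X card
    by (intro exI[of _ q] exI[of _ X] exI[of _ q]) (simp add: Q_def q_def)
  moreover have "has_aliasing p Q"
  proof -
    obtain v where v: "degree v = p" "lead_coeff v = 1" "poly_int (pderiv v * w) \<noteq> 0"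
    proof (cases "poly_int (pderiv (monom 1 p) * w) = 0")
      case False
      then show ?thesis by (intro that[of "monom 1 p"]) (simp_all add: degree_monom_eq)
    next
      case True
      \<comment> \<open>For \<open>p = 1\<close> the derivative of the monomial is 1 and the
        integral would be that of \<open>w\<close>, which is nonzero. With \<open>p \<ge> 2\<close>
        the added \<open>x\<close> leaves degree and leading coefficient alone and contributes
        exactly the integral of \<open>w\<close>.\<close>
      have "p \<noteq> 1"
      proof
        assume "p = 1"
        then have "pderiv (monom 1 p) = (1 :: real poly)"
          by (simp add: pderiv_monom)
        with True int_X show False by (simp add: w_def)
      qed
      then have "p \<ge> 2" using assms by simp
      have deg: "degree (monom 1 p + [:0, 1:] :: real poly) = p"
        using \<open>p \<ge> 2\<close> by (subst degree_add_eq_left) (auto simp: degree_monom_eq)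
      moreover have "lead_coeff (monom 1 p + [:0, 1:] :: real poly) = 1"
        using \<open>p \<ge> 2\<close> unfolding deg by (simp add: coeff_eq_0)
      moreover have "poly_int (pderiv (monom 1 p + [:0, 1:]) * w) \<noteq> 0"
        using True int_X
        by (simp add: pderiv_add distrib_right poly_int_add w_def pderiv_pCons)
      ultimately show ?thesis by (rule that)
    qed
    have "v \<noteq> 0" using v by auto
    then have "degree (v ^ 2) = q + 1"
      using v assms by (simp add: q_def degree_power_eq)
    moreover have "lead_coeff (v ^ 2) = 1"
      using v by (subst lead_coeff_power) simp
    ultimately have "Q (poly (v ^ 2)) = v ^ 2 - w"
      unfolding Q_def w_def using X card by (intro collocation_of_monic)
    then have "vol_int (\<lambda>x. poly (pderiv v) x * poly (Q (poly (v ^ 2))) x)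
        = poly_int (pderiv v * v ^ 2) - poly_int (pderiv v * w)"
      unfolding poly_int_diff[symmetric]
      by (intro vol_int_eq_poly_int) (simp add: right_diff_distrib)
    moreover have "vol_int (\<lambda>x. poly (pderiv v) x * poly (v ^ 2) x) = poly_int (pderiv v * v ^ 2)"
      by (rule vol_int_eq_poly_int) simp
    ultimately show ?thesis
      unfolding has_aliasing_def using v by (intro exI[of _ v]) auto
  qed
  ultimately show ?thesis by blast
qed

section \<open>Skew-symmetry\<close>

lemma sum_rotate:
  fixes F :: "'a \<Rightarrow> 'a \<Rightarrow> 'a \<Rightarrow> real"
  shows "(\<Sum>i\<in>A. \<Sum>j\<in>A. \<Sum>k\<in>A. F k i j) = (\<Sum>i\<in>A. \<Sum>j\<in>A. \<Sum>k\<in>A. F i j k)"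
proof -
  have "(\<Sum>i\<in>A. \<Sum>j\<in>A. \<Sum>k\<in>A. F k i j) = (\<Sum>i\<in>A. \<Sum>k\<in>A. \<Sum>j\<in>A. F k i j)"
    by (intro sum.cong refl sum.swap)
  also have "\<dots> = (\<Sum>k\<in>A. \<Sum>i\<in>A. \<Sum>j\<in>A. F k i j)"
    by (rule sum.swap)
  finally show ?thesis .
qed

text \<open>The weight \<open>a i * a j * a k\<close> is invariant under permutations of the
  indices, so the three tensor terms contribute equally.\<close>

lemma sum_cubic_symmetrize:
  fixes a :: "'a \<Rightarrow> real"
  shows "(\<Sum>i\<in>A. \<Sum>j\<in>A. \<Sum>k\<in>A. a i * a j * a k * (D i j k + D k i j + D k j i))
    = 3 * (\<Sum>i\<in>A. \<Sum>j\<in>A. \<Sum>k\<in>A. a i * a j * a k * D i j k)"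
proof -
  let ?S = "\<lambda>F :: 'a \<Rightarrow> 'a \<Rightarrow> 'a \<Rightarrow> real. \<Sum>i\<in>A. \<Sum>j\<in>A. \<Sum>k\<in>A. F i j k"
  let ?F = "\<lambda>i j k. a i * a j * a k * D i j k"
  have "?S (\<lambda>i j k. ?F k j i) = ?S (\<lambda>i j k. ?F k i j)"
    by (rule sum.swap)
  moreover have "?S (\<lambda>i j k. ?F k i j) = ?S ?F"
    by (rule sum_rotate)
  moreover have "?S (\<lambda>i j k. a i * a j * a k * (D i j k + D k i j + D k j i))
      = ?S ?F + ?S (\<lambda>i j k. ?F k i j) + ?S (\<lambda>i j k. ?F k j i)"
    by (simp add: algebra_simps sum.distrib)
  ultimately show ?thesis by simp
qed

lemma skew_symmetricI: "\<alpha> = 2 / 3 \<Longrightarrow> \<beta> = 1 / 3 \<Longrightarrow> skew_symmetric p P \<alpha> \<beta>"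
  unfolding skew_symmetric_def aliasing_tensor_eq_form aliasing_form_cyclic_sum
  by (hypsubst, simp)

lemma skew_symmetric_imp_entropy_rhs_0:
  assumes "skew_symmetric p P \<alpha> \<beta>"
  shows "entropy_rhs p P \<alpha> \<beta> a = 0"
proof -
  have "(\<Sum>i\<le>p. \<Sum>j\<le>p. \<Sum>k\<le>p. a i * a j * a k * (aliasing_tensor P \<alpha> \<beta> i j k
      + aliasing_tensor P \<alpha> \<beta> k i j + aliasing_tensor P \<alpha> \<beta> k j i)) = 0"
    using assms by (intro sum.neutral ballI) (simp add: skew_symmetric_def)
  then show ?thesis
    unfolding sum_cubic_symmetrize entropy_rhs_def by simp
qed

text \<open>Contracted with the Legendre coefficients of an aliased \<open>v\<close>, the tensor
  gives \<open>1 - 3 * \<beta>\<close> times the aliasing error of \<open>v\<close>. Skew-symmetry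
  makes this product zero while its second factor is not.\<close>

lemma skew_symmetric_with_aliasing:
  assumes valid: "valid_collocation p P" and "\<alpha> + \<beta> = 1"
    and "has_aliasing p P" "skew_symmetric p P \<alpha> \<beta>"
  shows "\<beta> = 1 / 3"
proof -
  obtain v where v: "degree v \<le> p"
      "vol_int (\<lambda>x. poly (pderiv v) x * poly (P (poly (v ^ 2))) x)
        \<noteq> vol_int (\<lambda>x. poly (pderiv v) x * poly (v ^ 2) x)"
    using assms(3) by (auto simp: has_aliasing_def)
  then have aliased: "poly_int (pderiv v * P (poly (v ^ 2))) \<noteq> poly_int (pderiv v * v ^ 2)"
    using vol_int_eq_poly_int[of "\<lambda>x. poly (pderiv v) x * poly (P (poly (v ^ 2))) x"
        "pderiv v * P (poly (v ^ 2))"]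
      vol_int_eq_poly_int[of "\<lambda>x. poly (pderiv v) x * poly (v ^ 2) x" "pderiv v * v ^ 2"]
    by simp
  obtain a where a: "v = (\<Sum>k\<le>p. smult (a k) (legendre k))"
    using legendre_expansion[OF v(1)] by blast
  have "aliasing_form P \<alpha> \<beta> v v v = 0"
    using skew_symmetric_imp_entropy_rhs_0[OF assms(4), of a]
    unfolding entropy_rhs_def aliasing_form_sum[OF valid a] by simp
  moreover have "poly_int (pderiv (v ^ 3)) = 3 * poly_int (pderiv v * v ^ 2)"
    using poly_int_pderiv_mult3[of v v v] by (simp add: power3_eq_cube power2_eq_square mult_ac)
  moreover have "\<alpha> = 1 - \<beta>" using assms(2) by simp
  ultimately have "(1 - 3 * \<beta>) * (poly_int (pderiv v * v ^ 2) - poly_int (pderiv v * P (poly (v ^ 2)))) = 0"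
    by (simp only: aliasing_form_diagonal) (simp add: algebra_simps)
  then show ?thesis using aliased by simp
qed

lemma entropy_stable_schemeI:
  assumes valid: "valid_collocation p P" and skew: "skew_symmetric p P \<alpha> \<beta>"
  shows "entropy_stable_scheme p P \<alpha> \<beta>"
  unfolding entropy_stable_scheme_def
  using discrete_entropy_has_derivative[OF valid] skew_symmetric_imp_entropy_rhs_0[OF skew]
  by fastforce

text \<open>For one projection the necessity in (c) rests on a nonzero aliasing error, hence the
  premise \<open>has_aliasing\<close>. The uniform version obtains such an error from a suitable
  projection for \<open>p \<ge> 1\<close>; for \<open>p = 0\<close> the tensor vanishes, since all
  Legendre polynomials involved are constant.\<close>

theorem mainTheorem3:
  fixes p :: nat and P :: "(real \<Rightarrow> real) \<Rightarrow> real poly" and \<alpha> \<beta> :: real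
    and \<Delta> :: "nat \<Rightarrow> nat \<Rightarrow> nat \<Rightarrow> real"
  assumes valid: "valid_collocation p P"
    and splitting: "\<alpha> + \<beta> = 1"
    and tensor: "\<Delta> = aliasing_tensor P \<alpha> \<beta>"
  shows
    "\<comment> \<open>(a)\<close>
     (\<forall>T fs c. time_interval T \<longrightarrow> split_form_solution p P \<alpha> \<beta> T fs c \<longrightarrow>
       (\<forall>t\<in>T.
          discrete_entropy p P c differentiable (at t within T) \<and>
          vector_derivative (discrete_entropy p P c) (at t within T)
            - bnd_int (\<lambda>x. 1 / 6 * poly (legendre_sum p c t) x ^ 3
                           - poly (legendre_sum p c t) x * fs x t)
            = - (1 / 2) * (\<Sum>i\<le>p. \<Sum>j\<le>p. \<Sum>k\<le>p. c i t * c j t * c k t * \<Delta> i j k) \<and>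
          - (1 / 2) * (\<Sum>i\<le>p. \<Sum>j\<le>p. \<Sum>k\<le>p. c i t * c j t * c k t * \<Delta> i j k)
            = - (1 / 6) * (\<Sum>i\<le>p. \<Sum>j\<le>p. \<Sum>k\<le>p.
                  c i t * c j t * c k t * (\<Delta> i j k + \<Delta> k i j + \<Delta> k j i)))) \<and>
     \<comment> \<open>(b)\<close>
     (\<forall>i\<le>p. \<forall>j\<le>p. \<forall>k\<le>p.
       \<Delta> i j k + \<Delta> k i j + \<Delta> k j i =
         (1 - 3 * \<beta>) * bnd_int (\<lambda>x. poly (legendre i) x * poly (legendre j) x * poly (legendre k) x)
         + (2 * \<beta> - \<alpha>) * vol_int (\<lambda>x.
               poly (pderiv (legendre i)) x * poly (P (poly (legendre j * legendre k))) x
             + poly (pderiv (legendre j)) x * poly (P (poly (legendre i * legendre k))) x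
             + poly (pderiv (legendre k)) x * poly (P (poly (legendre i * legendre j))) x)) \<and>
     \<comment> \<open>(c), one projection that is not free of aliasing\<close>
     (has_aliasing p P \<longrightarrow>
       (skew_symmetric p P \<alpha> \<beta> \<longleftrightarrow> 1 - 3 * \<beta> = 0 \<and> 2 * \<beta> - \<alpha> = 0)) \<and>
     \<comment> \<open>(c), uniformly in the projection\<close>
     (p \<ge> 1 \<longrightarrow>
       ((\<forall>Q. valid_collocation p Q \<longrightarrow> skew_symmetric p Q \<alpha> \<beta>)
          \<longleftrightarrow> 1 - 3 * \<beta> = 0 \<and> 2 * \<beta> - \<alpha> = 0)) \<and>
     (1 - 3 * \<beta> = 0 \<and> 2 * \<beta> - \<alpha> = 0 \<longleftrightarrow> \<alpha> = 2 / 3 \<and> \<beta> = 1 / 3) \<and>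
     (\<alpha> = 2 / 3 \<and> \<beta> = 1 / 3 \<longrightarrow> skew_symmetric p P \<alpha> \<beta>) \<and>
     \<comment> \<open>(c), consequences\<close>
     (\<alpha> = 2 / 3 \<and> \<beta> = 1 / 3 \<longrightarrow>
       (\<forall>a. - (1 / 2) * (\<Sum>i\<le>p. \<Sum>j\<le>p. \<Sum>k\<le>p. a i * a j * a k * \<Delta> i j k) = 0) \<and> entropy_stable_scheme p P \<alpha> \<beta>)"
proof -
  note has_derivative = discrete_entropy_has_derivative[OF valid]
  have differentiable: "discrete_entropy p P c differentiable (at t within T)"
    if "time_interval T" "split_form_solution p P \<alpha> \<beta> T fs c" "t \<in> T" for T fs c t
    using has_derivative[OF that(1,3,2)] by (auto simp: real_differentiable_def)
  have entropy_equation: "vector_derivative (discrete_entropy p P c) (at t within T)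
      - surface_term p fs c t = entropy_rhs p P \<alpha> \<beta> (\<lambda>k. c k t)"
    if "time_interval T" "split_form_solution p P \<alpha> \<beta> T fs c" "t \<in> T" for T fs c t
  proof -
    have "vector_derivative (discrete_entropy p P c) (at t within T)
        = surface_term p fs c t + entropy_rhs p P \<alpha> \<beta> (\<lambda>k. c k t)"
      using has_derivative[OF that(1,3,2)]
      by (intro vector_derivative_within time_interval_not_bot that)
         (simp add: has_real_derivative_iff_has_vector_derivative)
    then show ?thesis by simp
  qed
  have symmetrized: "- (1 / 2) * (\<Sum>i\<le>p. \<Sum>j\<le>p. \<Sum>k\<le>p. a i * a j * a k * \<Delta> i j k)
      = - (1 / 6) * (\<Sum>i\<le>p. \<Sum>j\<le>p. \<Sum>k\<le>p. a i * a j * a k * (\<Delta> i j k + \<Delta> k i j + \<Delta> k j i))" for a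
    unfolding sum_cubic_symmetrize by simp
  have cyclic_sum: "\<Delta> i j k + \<Delta> k i j + \<Delta> k j i =
         (1 - 3 * \<beta>) * bnd_int (\<lambda>x. poly (legendre i) x * poly (legendre j) x * poly (legendre k) x)
         + (2 * \<beta> - \<alpha>) * vol_int (\<lambda>x.
               poly (pderiv (legendre i)) x * poly (P (poly (legendre j * legendre k))) x
             + poly (pderiv (legendre j)) x * poly (P (poly (legendre i * legendre k))) x
             + poly (pderiv (legendre k)) x * poly (P (poly (legendre i * legendre j))) x)" for i j k
  proof -
    have "vol_int (\<lambda>x. poly f x * poly f' x + poly g x * poly g' x + poly h x * poly h' x)
        = poly_int (f * f') + poly_int (g * g') + poly_int (h * h')" for f g h f' g' h'
      unfolding poly_int_add[symmetric] by (rule vol_int_eq_poly_int) simp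
    then show ?thesis
      unfolding tensor aliasing_tensor_eq_form aliasing_form_cyclic_sum
      by (simp only: poly_int_pderiv bnd_int_def poly_mult)
  qed
  have coefficients: "1 - 3 * \<beta> = 0 \<and> 2 * \<beta> - \<alpha> = 0 \<longleftrightarrow> \<alpha> = 2 / 3 \<and> \<beta> = 1 / 3"
    by auto
  have necessary: "\<alpha> = 2 / 3 \<and> \<beta> = 1 / 3"
    if "valid_collocation p Q" "has_aliasing p Q" "skew_symmetric p Q \<alpha> \<beta>" for Q
    using skew_symmetric_with_aliasing[OF that(1) splitting that(2,3)] splitting by simp
  have sufficient: "skew_symmetric p Q \<alpha> \<beta>" if "\<alpha> = 2 / 3 \<and> \<beta> = 1 / 3" for Q
    using that by (simp add: skew_symmetricI)
  have single: "skew_symmetric p P \<alpha> \<beta> \<longleftrightarrow> \<alpha> = 2 / 3 \<and> \<beta> = 1 / 3" if "has_aliasing p P"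
    using necessary[OF valid that] sufficient by blast
  \<comment> \<open>For necessity \<open>Q\<close> is instantiated with a valid projection that has
    aliasing.\<close>
  have uniform: "(\<forall>Q. valid_collocation p Q \<longrightarrow> skew_symmetric p Q \<alpha> \<beta>)
      \<longleftrightarrow> \<alpha> = 2 / 3 \<and> \<beta> = 1 / 3" if "p \<ge> 1"
    using aliasing_collocation_exists[OF that] necessary sufficient by blast
  have rhs_0: "- (1 / 2) * (\<Sum>i\<le>p. \<Sum>j\<le>p. \<Sum>k\<le>p. a i * a j * a k * \<Delta> i j k) = 0"
    if "\<alpha> = 2 / 3 \<and> \<beta> = 1 / 3" for a
    using skew_symmetric_imp_entropy_rhs_0[OF sufficient[OF that]]
    unfolding entropy_rhs_def tensor .
  have stable: "entropy_stable_scheme p P \<alpha> \<beta>" if "\<alpha> = 2 / 3 \<and> \<beta> = 1 / 3"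
    using entropy_stable_schemeI[OF valid sufficient[OF that]] .
  show ?thesis
    \<comment> \<open>This rewrites the vanishing of both factors as the values of \<alpha> and
      \<beta> everywhere, so the conjunct relating the two becomes reflexive.\<close>
    unfolding coefficients
    by (intro conjI allI impI ballI)
      (rule refl symmetrized cyclic_sum
      | (rule differentiable entropy_equation[unfolded surface_term_def entropy_rhs_def, folded tensor]
          single uniform sufficient rhs_0 stable; assumption))+
qed

end
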